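(* Let $n \ge 1$ and $h$ be integers with $h \le n-1$. In the $h$-AO-SP with $n$ online candidates, the algorithm described below (Algorithm 1) is $\frac{h}{n+h-1}$-competitive. Algorithm 1: set $T_0 \leftarrow H$; when candidate $c_\ell$ arrives at round $\ell$, set $T_\ell \leftarrow T_{\ell-1}\cup\{c_\ell\}$, and if $c_\ell = \max T_\ell$ then accept $c_\ell$ and terminate.
   Context: The adversarial-order secretary problem with a sample of size $h$ ($h$-AO-SP), for integers $n\ge 1$, $h\ge 0$: an adversary picks a set $C$ of $n+h$ candidates, each with a value in $\mathbb{R}_{\ge 0}$ (candidates are totally ordered by value, ties broken by a fixed consistent tie-breaker; a candidate is identified with its value). A subset $H\subseteq C$ of cardinality $h$ (the history set) is drawn uniformly at random and given, together with $n$, to the online player upfront; $O = C\setminus H$ is the online set. The adversary then chooses an order $c_1,\dots,c_n$ of $O$ (which may depend on $H$), and the candidates are revealed one by one; after each arrival the player must irrevocably accept or reject the current candidate, and accepting terminates the process. $\mathrm{ALG}$ denotes the value of the accepted candidate (0 if none) and $\mathrm{OPT}=\max O$. An algorithm is $c$-competitive if for every choice of $C$ (with $|C|=n+h$) and every adversarial ordering strategy, $\mathbb{E}[\mathrm{ALG}]\ge c\,\mathbb{E}[\mathrm{OPT}]$, where the expectation is over the random choice of $H$ and the algorithm's internal randomness. *)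

theory Defs
  imports "HOL-Probability.Probability_Mass_Function"
begin

(* A candidate carries its value together with a label that only serves to break ties.
   The library's product types are not used because HOL-Probability already pulls in
   their componentwise (non-linear) order. *)
datatype 'a candidate = Candidate (val: real) (label: 'a)

instantiation candidate :: (linorder) linorder
begin

definition less_eq_candidate :: "'a candidate \<Rightarrow> 'a candidate \<Rightarrow> bool" where
  "x \<le> y \<longleftrightarrow> val x < val y \<or> (val x = val y \<and> label x \<le> label y)"

definition less_candidate :: "'a candidate \<Rightarrow> 'a candidate \<Rightarrow> bool" where
  "x < y \<longleftrightarrow> val x < val y \<or> (val x = val y \<and> label x < label y)"

instance
  by standard (auto simp: less_eq_candidate_def less_candidate_def intro: candidate.expand)

end

(* An online algorithm is given n, the history set and the candidates observed so far in
   order of arrival, the current one last; it returns the distribution of its decision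
   (True = accept). It never has access to the candidates still to come. *)
type_synonym 'a algorithm = "nat \<Rightarrow> 'a candidate set \<Rightarrow> 'a candidate list \<Rightarrow> bool pmf"

(* The last two arguments are the rejected and the forthcoming candidates;
   the result is the accepted candidate, if any. *)
fun run :: "'a algorithm \<Rightarrow> nat \<Rightarrow> 'a candidate set \<Rightarrow> 'a candidate list \<Rightarrow> 'a candidate list
    \<Rightarrow> 'a candidate option pmf" where
  "run A n H seen [] = return_pmf None"
| "run A n H seen (c # cs) =
     bind_pmf (A n H (seen @ [c]))
       (\<lambda>accept. if accept then return_pmf (Some c) else run A n H (seen @ [c]) cs)"

definition histories :: "nat \<Rightarrow> 'a candidate set \<Rightarrow> 'a candidate set set" where
  "histories h C = {H. H \<subseteq> C \<and> card H = h}"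

definition ordering_strategy ::
    "nat \<Rightarrow> 'a candidate set \<Rightarrow> ('a candidate set \<Rightarrow> 'a candidate list) \<Rightarrow> bool" where
  "ordering_strategy h C \<sigma> \<longleftrightarrow> (\<forall>H \<in> histories h C. distinct (\<sigma> H) \<and> set (\<sigma> H) = C - H)"

definition accepted_value :: "'a candidate option \<Rightarrow> real" where
  "accepted_value r = (case r of None \<Rightarrow> 0 | Some c \<Rightarrow> val c)"

definition expected_ALG :: "'a algorithm \<Rightarrow> nat \<Rightarrow> nat \<Rightarrow> 'a candidate set
    \<Rightarrow> ('a candidate set \<Rightarrow> 'a candidate list) \<Rightarrow> real" where
  "expected_ALG A n h C \<sigma> =
     measure_pmf.expectation
       (bind_pmf (pmf_of_set (histories h C)) (\<lambda>H. run A n H [] (\<sigma> H)))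
       accepted_value"

definition expected_OPT :: "nat \<Rightarrow> 'a::linorder candidate set \<Rightarrow> real" where
  "expected_OPT h C =
     measure_pmf.expectation (pmf_of_set (histories h C)) (\<lambda>H. val (Max (C - H)))"

definition competitive :: "nat \<Rightarrow> nat \<Rightarrow> real \<Rightarrow> 'a::linorder algorithm \<Rightarrow> bool" where
  "competitive n h c A \<longleftrightarrow>
     (\<forall>C \<sigma>. finite C \<and> card C = n + h \<and> (\<forall>x\<in>C. 0 \<le> val x) \<and> ordering_strategy h C \<sigma>
        \<longrightarrow> expected_ALG A n h C \<sigma> \<ge> c * expected_OPT h C)"

(* After the arrivals in seen, the set T of all candidates known so far is H \<union> set seen. *)
definition algorithm1 :: "'a::linorder algorithm" where
  "algorithm1 n H seen = return_pmf (last seen = Max (H \<union> set seen))"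

end

(* Let N = n + h and let x be the candidate of rank m in C.  If every candidate of rank at most m
   is online and the next one is in H, then the algorithm accepts a candidate of value at least
   that of x; there are (N - m - 1) choose (h - 1) such histories.  On the other hand x is the
   online maximum for (N - m) choose (h + 1 - m) histories.  So the claim follows by comparing
   the coefficients of val x for each rank separately. *)
theory Submission imports Defs begin

section \<open>Binomial coefficients and subsets of a given size\<close>

text \<open>The hypotheses say that \<open>b\<close> is at least as far from \<open>M / 2\<close> as
  \<open>a\<close>. For \<open>b \<le> M\<close>: if \<open>a\<close> is in the lower half,
  \<open>b\<close> is reflected to \<open>M - b \<le> a\<close>; otherwise both are in the upper
  half, where the coefficients decrease.\<close>

lemma binomial_le_binomial_of_nearer_middle:
  fixes M a b :: nat
  assumes "a \<le> b" and "M \<le> a + b"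
  shows "M choose b \<le> M choose a"
proof (cases "b \<le> M")
  case True
  show ?thesis
  proof (cases "2 * a \<le> M")
    case True
    have "M choose b = M choose (M - b)"
      using \<open>b \<le> M\<close> by (rule binomial_symmetric)
    also have "\<dots> \<le> M choose a"
      using assms True by (intro binomial_mono) auto
    finally show ?thesis .
  next
    case False
    then show ?thesis
      using assms \<open>b \<le> M\<close> by (intro binomial_antimono) auto
  qed
qed (simp add: binomial_eq_0)

text \<open>Removing \<open>A\<close> from \<open>H\<close> leaves an arbitrary subset of
  \<open>B - A\<close>. The bound on \<open>card A\<close> guards against truncated subtraction: for
  a larger \<open>A\<close> there is no such \<open>H\<close>, but the right-hand side would be
  1.\<close>

lemma card_subsets_between:
  assumes "finite B" and "A \<subseteq> B" and "card A \<le> k"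
  shows "card {H. A \<subseteq> H \<and> H \<subseteq> B \<and> card H = k} = (card B - card A) choose (k - card A)"
proof -
  have fA: "finite A" using assms finite_subset by blast
  have "bij_betw (\<lambda>K. A \<union> K) {K. K \<subseteq> B - A \<and> card K = k - card A}
          {H. A \<subseteq> H \<and> H \<subseteq> B \<and> card H = k}"
  proof (rule bij_betw_byWitness[where f' = "\<lambda>H. H - A"])
    show "(\<lambda>K. A \<union> K) ` {K. K \<subseteq> B - A \<and> card K = k - card A}
            \<subseteq> {H. A \<subseteq> H \<and> H \<subseteq> B \<and> card H = k}"
    proof
      fix L assume "L \<in> (\<lambda>K. A \<union> K) ` {K. K \<subseteq> B - A \<and> card K = k - card A}"
      then obtain K where K: "K \<subseteq> B - A" "card K = k - card A" "L = A \<union> K" by blast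
      have "finite K" using K assms by (meson finite_Diff finite_subset)
      then have "card (A \<union> K) = card A + card K"
        using K fA by (intro card_Un_disjoint) auto
      then show "L \<in> {H. A \<subseteq> H \<and> H \<subseteq> B \<and> card H = k}" using K assms by auto
    qed
    show "(\<lambda>H. H - A) ` {H. A \<subseteq> H \<and> H \<subseteq> B \<and> card H = k}
            \<subseteq> {K. K \<subseteq> B - A \<and> card K = k - card A}"
      using fA by (auto simp: card_Diff_subset)
  qed auto
  then have "card {H. A \<subseteq> H \<and> H \<subseteq> B \<and> card H = k}
      = card {K. K \<subseteq> B - A \<and> card K = k - card A}"
    by (simp add: bij_betw_same_card)
  also have "\<dots> = (card B - card A) choose (k - card A)"
    using assms fA by (simp add: n_subsets card_Diff_subset)
  finally show ?thesis .
qed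

section \<open>Runs of the algorithm\<close>

lemma set_pmf_run: "set_pmf (run A n H seen cs) \<subseteq> insert None (Some ` set cs)"
proof (induction cs arbitrary: seen)
  case (Cons c cs)
  then show ?case by (auto split: if_splits dest!: subsetD[OF Cons.IH])
qed simp

lemma finite_set_pmf_run: "finite (set_pmf (run A n H seen cs))"
  using set_pmf_run by (rule finite_subset) simp

text \<open>Until some arrival exceeds \<open>Max H\<close>, the best known candidate is
  \<open>Max H\<close>, so nothing is accepted; the first arrival above it is the maximum so far and
  is taken, whatever the order. The condition on \<open>seen\<close> is the induction
  invariant.\<close>

lemma run_algorithm1_accepts:
  assumes "finite H" and "H \<noteq> {}" and "set cs \<inter> H = {}"
    and "\<forall>s\<in>set seen. s < Max H" and "\<exists>c\<in>set cs. Max H < c"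
  shows "\<exists>c\<in>set cs. Max H < c \<and> run algorithm1 n H seen cs = return_pmf (Some c)"
  using assms(3-)
proof (induction cs arbitrary: seen)
  case (Cons c cs)
  have "c \<noteq> Max H" using Cons.prems(1) assms(1,2) Max_in by auto
  define b where "b = Max H"
  have b: "b \<in> H" "\<forall>z\<in>H. z \<le> b" "\<forall>s\<in>set seen. s < b"
    using assms(1,2) Cons.prems(2) by (auto simp: b_def)
  have "Max (H \<union> set (seen @ [c])) = max b c"
    using b assms(1) by (intro Max_eqI) (auto simp: le_max_iff_disj max_def less_imp_le)
  then have Max_eq: "Max (H \<union> set (seen @ [c])) = max (Max H) c"
    by (simp add: b_def)
  show ?case
  proof (cases "Max H < c")
    case True
    then have "run algorithm1 n H seen (c # cs) = return_pmf (Some c)"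
      using Max_eq by (simp add: algorithm1_def bind_return_pmf max_def less_imp_le)
    then show ?thesis using True by auto
  next
    case False
    then have "c < Max H" using \<open>c \<noteq> Max H\<close> by auto
    moreover from this have "run algorithm1 n H seen (c # cs) = run algorithm1 n H (seen @ [c]) cs"
      using Max_eq \<open>c \<noteq> Max H\<close> by (simp add: algorithm1_def bind_return_pmf max.absorb3)
    ultimately show ?thesis
      using Cons.IH[of "seen @ [c]"] Cons.prems by auto
  qed
qed simp

section \<open>The inequality between the two counts at rank \<open>m\<close>\<close>

text \<open>After replacing the lower index by \<open>h\<close>, absorption gives the factor
  \<open>M / h\<close> with \<open>M = n + h - m\<close>. It is largest at \<open>m = 1\<close>,
  where the whole inequality is an equality; this is where the ratio comes from.\<close>

lemma binomial_rank_comparison: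
  assumes "1 \<le> h" and "h \<le> n - 1" and "1 \<le> m" and "m \<le> h + 1"
  shows "real h / (real n + real h - 1) * real ((n + h - m) choose (h + 1 - m))
           \<le> real ((n + h - m - 1) choose (h - 1))"
proof -
  define M where "M = n + h - m"
  have M: "M \<ge> 1" "M \<le> n + h - 1" "n - 1 \<le> M" "real M \<le> real n + real h - 1"
    using assms by (auto simp: M_def of_nat_diff)
  \<comment> \<open>The lower index is \<open>M - (n - 1)\<close>.\<close>
  have "M choose (h + 1 - m) = M choose (n - 1)"
    using binomial_symmetric[of "n - 1" M] assms M by (simp add: M_def)
  \<comment> \<open>Here \<open>h \<le> n - 1\<close> enters, together with
    \<open>M \<le> h + (n - 1)\<close>, which amounts to \<open>m \<ge> 1\<close>.\<close>
  also have "\<dots> \<le> M choose h"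
    using assms M by (intro binomial_le_binomial_of_nearer_middle) auto
  finally have le: "real (M choose (h + 1 - m)) \<le> real (M choose h)" by simp
  have absorb: "real h * real (M choose h) = real M * real ((M - 1) choose (h - 1))"
    using binomial_absorption[of "h - 1" "M"] assms(1)
    by (metis Suc_diff_1 less_le_trans of_nat_mult zero_less_one)
  have "real h * real (M choose (h + 1 - m)) \<le> real h * real (M choose h)"
    using le by (intro mult_left_mono) auto
  also have "\<dots> \<le> (real n + real h - 1) * real ((M - 1) choose (h - 1))"
    unfolding absorb using M by (intro mult_right_mono) auto
  finally show ?thesis
    using M assms by (simp add: M_def field_simps)
qed

section \<open>Expectations as averages over histories\<close>

text \<open>With the analogous formula for OPT, both expectations get the same denominator, so only
  the two sums have to be compared. The bound on \<open>h\<close> makes the set of histories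
  nonempty.\<close>

lemma expected_ALG_eq_sum:
  assumes "finite C" and "h \<le> card C"
  shows "expected_ALG A n h C \<sigma> =
    (\<Sum>H\<in>histories h C. measure_pmf.expectation (run A n H [] (\<sigma> H)) accepted_value)
      / real (card (histories h C))"
proof -
  have "histories h C \<noteq> {}" "finite (histories h C)"
    using assms obtain_subset_with_card_n[of h C] by (auto simp: histories_def)
  then show ?thesis
    unfolding expected_ALG_def
    by (subst pmf_expectation_bind_pmf_of_set)
      (auto simp: finite_set_pmf_run sum_divide_distrib field_simps intro!: sum.cong)
qed

lemma expected_OPT_eq_sum:
  assumes "finite C" and "h \<le> card C"
  shows "expected_OPT h C =
    (\<Sum>H\<in>histories h C. val (Max (C - H))) / real (card (histories h C))"
proof -
  have "histories h C \<noteq> {}" "finite (histories h C)"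
    using assms obtain_subset_with_card_n[of h C] by (auto simp: histories_def)
  then show ?thesis
    unfolding expected_OPT_def by (simp add: integral_pmf_of_set)
qed

section \<open>Counting the histories attached to a candidate\<close>

definition online_max_histories ::
    "nat \<Rightarrow> 'a::linorder candidate set \<Rightarrow> 'a candidate \<Rightarrow> 'a candidate set set" where
  "online_max_histories h C x = {H \<in> histories h C. Max (C - H) = x}"

(* The predecessor of x in C belongs to H, hence is its maximum. *)
definition next_above_histories ::
    "nat \<Rightarrow> 'a::linorder candidate set \<Rightarrow> 'a candidate \<Rightarrow> 'a candidate set set" where
  "next_above_histories h C x =
     {H \<in> histories h C. H \<subseteq> {c\<in>C. c < x} \<and> H \<noteq> {} \<and> Max {c\<in>C. c < x} \<in> H}"

lemma card_rank:
  fixes C :: "'a::linorder set"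
  assumes "finite C" and "x \<in> C"
  shows "card {c\<in>C. c < x} + card {c\<in>C. x < c} + 1 = card C"
proof -
  have "C = insert x ({c\<in>C. c < x} \<union> {c\<in>C. x < c})" using assms by auto
  then have "card C = card (insert x ({c\<in>C. c < x} \<union> {c\<in>C. x < c}))" by simp
  also have "\<dots> = Suc (card ({c\<in>C. c < x} \<union> {c\<in>C. x < c}))" using assms by simp
  also have "card ({c\<in>C. c < x} \<union> {c\<in>C. x < c}) = card {c\<in>C. c < x} + card {c\<in>C. x < c}"
    using assms by (intro card_Un_disjoint) auto
  finally show ?thesis by simp
qed

text \<open>\<open>x\<close> is the online maximum exactly when \<open>H\<close> contains everything
  above \<open>x\<close> but not \<open>x\<close> itself, so \<open>H\<close> lies between two fixed
  sets. If more than \<open>h\<close> candidates are above \<open>x\<close>, there is no room for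
  them in \<open>H\<close>.\<close>

lemma card_online_max_histories:
  assumes "finite C" and "x \<in> C" and "h < card C"
  shows "card (online_max_histories h C x) =
    (if card {c\<in>C. x < c} \<le> h
     then card {c\<in>C. c < x} choose (h - card {c\<in>C. x < c}) else 0)"
proof -
  have eq: "online_max_histories h C x =
      {H. {c\<in>C. x < c} \<subseteq> H \<and> H \<subseteq> C - {x} \<and> card H = h}"
  proof (intro equalityI subsetI CollectI)
    fix H assume "H \<in> online_max_histories h C x"
    then have H: "H \<subseteq> C" "card H = h" "Max (C - H) = x"
      by (auto simp: online_max_histories_def histories_def)
    have "C - H \<noteq> {}" using H assms by auto
    then have "x \<in> C - H" "\<forall>c\<in>C - H. c \<le> x"
      using H assms Max_in[of "C - H"] by auto
    then show "{c\<in>C. x < c} \<subseteq> H \<and> H \<subseteq> C - {x} \<and> card H = h" using H by force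
  next
    fix H assume H: "H \<in> {H. {c\<in>C. x < c} \<subseteq> H \<and> H \<subseteq> C - {x} \<and> card H = h}"
    have "Max (C - H) = x"
      using H assms by (intro Max_eqI) (auto simp: not_less[symmetric])
    then show "H \<in> online_max_histories h C x"
      using H by (auto simp: online_max_histories_def histories_def)
  qed
  show ?thesis
  proof (cases "card {c\<in>C. x < c} \<le> h")
    case True
    have "card (C - {x}) - card {c\<in>C. x < c} = card {c\<in>C. c < x}"
      using card_rank[OF assms(1,2)] assms by simp
    then show ?thesis
      unfolding eq using assms True by (subst card_subsets_between) auto
  next
    case False
    have "\<not> ({c\<in>C. x < c} \<subseteq> H \<and> H \<subseteq> C - {x} \<and> card H = h)" for H
      using False assms(1) by (metis card_mono finite_Diff finite_subset)
    then have "online_max_histories h C x = {}" unfolding eq by blast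
    then show ?thesis using False by simp
  qed
qed

text \<open>One element of \<open>H\<close>, the predecessor of \<open>x\<close>, is forced; the
  other \<open>h - 1\<close> are free among the remaining candidates below \<open>x\<close>.\<close>

lemma card_next_above_histories:
  assumes "finite C" and "1 \<le> h" and "{c\<in>C. c < x} \<noteq> {}"
  shows "card (next_above_histories h C x) = (card {c\<in>C. c < x} - 1) choose (h - 1)"
proof -
  define D where "D = {c\<in>C. c < x}"
  have "next_above_histories h C x = {H. {Max D} \<subseteq> H \<and> H \<subseteq> D \<and> card H = h}"
    by (auto simp: next_above_histories_def histories_def D_def)
  moreover have "finite D" "Max D \<in> D"
    using assms Max_in[of D] unfolding D_def by auto
  ultimately show ?thesis
    using assms card_subsets_between[of D "{Max D}" h] by (simp add: D_def)
qed

lemma Max_next_above_histories: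
  assumes "finite C" and "H \<in> next_above_histories h C x"
  shows "Max H = Max {c\<in>C. c < x}"
  using assms by (intro Max_eqI) (auto simp: next_above_histories_def intro: finite_subset)

text \<open>\<open>Max H\<close> is the predecessor of \<open>x\<close> in \<open>C\<close>, so no
  candidate lies strictly between them.\<close>

lemma next_above_histories_threshold:
  assumes "finite C" and "H \<in> next_above_histories h C x" and "c \<in> C" and "Max H < c"
  shows "x \<le> c"
proof (rule ccontr)
  assume "\<not> x \<le> c"
  then have "c \<le> Max {c\<in>C. c < x}" using assms by simp
  then show False using assms Max_next_above_histories by fastforce
qed

lemma Max_less_next_above_histories:
  assumes "finite C" and "H \<in> next_above_histories h C x"
  shows "Max H < x"
proof -
  have "H \<subseteq> {c\<in>C. c < x}" "H \<noteq> {}" using assms by (auto simp: next_above_histories_def)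
  moreover have "finite H" using calculation assms by (simp add: finite_subset)
  ultimately show ?thesis by (auto simp: subset_iff)
qed

section \<open>Lower bound for the algorithm\<close>

text \<open>\<open>x\<close> is online and above \<open>Max H\<close>, so some candidate above
  \<open>Max H\<close> is accepted, and every such candidate is at least \<open>x\<close>.\<close>

lemma algorithm1_value_ge:
  assumes "finite C" and "x \<in> C" and H: "H \<in> next_above_histories h C x"
    and "set cs = C - H"
  shows "val x \<le> measure_pmf.expectation (run algorithm1 n H [] cs) accepted_value"
proof -
  have "H \<subseteq> C" "H \<noteq> {}" and "x \<notin> H"
    using H by (auto simp: next_above_histories_def)
  moreover have "finite H" using \<open>H \<subseteq> C\<close> assms(1) finite_subset by blast
  moreover have "Max H < x" using assms Max_less_next_above_histories by blast
  ultimately obtain c where c: "c \<in> set cs" "Max H < c"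
      "run algorithm1 n H [] cs = return_pmf (Some c)"
    using run_algorithm1_accepts[of H cs "[]" n] assms(2,4) by auto
  then have "x \<le> c" using assms next_above_histories_threshold by blast
  then have "val x \<le> val c" by (auto simp: less_eq_candidate_def)
  then show ?thesis using c by (simp add: accepted_value_def)
qed

text \<open>The classes \<open>next_above_histories h C x\<close> are disjoint for different
  \<open>x\<close>, so the pointwise bounds may be added without counting a history twice.\<close>

lemma sum_algorithm1_ge:
  assumes "finite C" and "\<forall>x\<in>C. 0 \<le> val x" and "ordering_strategy h C \<sigma>"
  shows "(\<Sum>x\<in>C. real (card (next_above_histories h C x)) * val x)
    \<le> (\<Sum>H\<in>histories h C. measure_pmf.expectation (run algorithm1 n H [] (\<sigma> H)) accepted_value)"
    (is "_ \<le> (\<Sum>H\<in>_. ?alg H)")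
proof -
  have fin: "finite (histories h C)" using assms by (simp add: histories_def)
  have sub: "next_above_histories h C x \<subseteq> histories h C" for x
    by (auto simp: next_above_histories_def)
  have \<sigma>: "set (\<sigma> H) = C - H" if "H \<in> histories h C" for H
    using assms that by (simp add: ordering_strategy_def)
  have "(\<Sum>x\<in>C. real (card (next_above_histories h C x)) * val x)
      = (\<Sum>x\<in>C. \<Sum>H\<in>next_above_histories h C x. val x)" by simp
  also have "\<dots> \<le> (\<Sum>x\<in>C. \<Sum>H\<in>next_above_histories h C x. ?alg H)"
    using assms \<sigma> sub by (intro sum_mono algorithm1_value_ge) auto
  also have "\<dots> = (\<Sum>H\<in>(\<Union>x\<in>C. next_above_histories h C x). ?alg H)"
  proof (rule sum.UNION_disjoint[symmetric])
    \<comment> \<open>A history determines \<open>x\<close> as the least candidate above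
      \<open>Max H\<close>.\<close>
    show "\<forall>x\<in>C. \<forall>y\<in>C. x \<noteq> y \<longrightarrow> next_above_histories h C x \<inter> next_above_histories h C y = {}"
    proof (intro ballI impI equals0I)
      fix x y H assume "x \<in> C" "y \<in> C" "x \<noteq> y"
        and "H \<in> next_above_histories h C x \<inter> next_above_histories h C y"
      then have H: "H \<in> next_above_histories h C x" "H \<in> next_above_histories h C y" by auto
      have "x \<le> y"
        using next_above_histories_threshold[OF assms(1) H(1) \<open>y \<in> C\<close>]
          Max_less_next_above_histories[OF assms(1) H(2)] .
      moreover have "y \<le> x"
        using next_above_histories_threshold[OF assms(1) H(2) \<open>x \<in> C\<close>]
          Max_less_next_above_histories[OF assms(1) H(1)] .
      ultimately show False using \<open>x \<noteq> y\<close> by simp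
    qed
    show "\<forall>x\<in>C. finite (next_above_histories h C x)"
      using finite_subset[OF sub fin] by simp
  qed fact
  also have "\<dots> \<le> (\<Sum>H\<in>histories h C. ?alg H)"
  \<comment> \<open>The histories in no class are the empty one and those containing
    \<open>Max C\<close>; their contribution is bounded below by 0.\<close>
  proof (rule sum_mono2[OF fin])
    fix H assume "H \<in> histories h C - (\<Union>x\<in>C. next_above_histories h C x)"
    then have "set (\<sigma> H) = C - H" using \<sigma> by blast
    then have "0 \<le> accepted_value r" if "r \<in> insert None (Some ` set (\<sigma> H))" for r
      using that assms(2) by (auto simp: accepted_value_def)
    then have "AE r in run algorithm1 n H [] (\<sigma> H). 0 \<le> accepted_value r"
      using set_pmf_run[of algorithm1 n H "[]" "\<sigma> H"] by (auto simp only: AE_measure_pmf_iff)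
    then show "0 \<le> ?alg H" by (rule integral_nonneg_AE)
  next
    show "(\<Union>x\<in>C. next_above_histories h C x) \<subseteq> histories h C"
      using sub by (rule UN_least)
  qed
  finally show ?thesis .
qed

section \<open>Comparing coefficients candidate by candidate\<close>

lemma sum_online_max_eq:
  assumes "finite C" and "h < card C"
  shows "(\<Sum>H\<in>histories h C. val (Max (C - H)))
    = (\<Sum>x\<in>C. real (card (online_max_histories h C x)) * val x)"
proof -
  have "Max (C - H) \<in> C" if "H \<in> histories h C" for H
  proof -
    have "C - H \<noteq> {}" using that assms by (auto simp: histories_def)
    then show ?thesis using Max_in[of "C - H"] assms by auto
  qed
  then have "(\<lambda>H. Max (C - H)) ` histories h C \<subseteq> C" by auto
  then have "(\<Sum>H\<in>histories h C. val (Max (C - H)))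
      = (\<Sum>x\<in>C. \<Sum>H\<in>online_max_histories h C x. val (Max (C - H)))"
    unfolding online_max_histories_def
    using assms by (intro sum.group[symmetric]) (auto simp: histories_def)
  also have "\<dots> = (\<Sum>x\<in>C. \<Sum>H\<in>online_max_histories h C x. val x)"
    by (intro sum.cong) (auto simp: online_max_histories_def)
  finally show ?thesis by simp
qed

lemma card_histories_comparison:
  assumes "finite C" and "card C = n + h" and "x \<in> C" and "n \<ge> 1" and "h \<le> n - 1"
  shows "real h / (real n + real h - 1) * real (card (online_max_histories h C x))
    \<le> real (card (next_above_histories h C x))"
proof (cases "1 \<le> h \<and> card {c\<in>C. x < c} \<le> h")
  case True
  \<comment> \<open>Ranks count from the top, the best candidate having rank 1.\<close>
  define m where "m = card {c\<in>C. x < c} + 1"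
  have m: "1 \<le> m" "m \<le> h + 1" using True by (auto simp: m_def)
  have below: "card {c\<in>C. c < x} = n + h - m"
    using card_rank[OF assms(1,3)] assms by (simp add: m_def)
  \<comment> \<open>Since \<open>m \<le> h + 1\<close> and \<open>n - 1 \<ge> h \<ge> 1\<close>,
    \<open>x\<close> is not the least candidate and has a predecessor.\<close>
  have "n + h - m \<noteq> 0" using True assms(5) by (auto simp: m_def)
  then have "{c\<in>C. c < x} \<noteq> {}" unfolding below[symmetric] by (rule contrapos_nn) (simp only: card.empty)
  then have "card (next_above_histories h C x) = (n + h - m - 1) choose (h - 1)"
    using card_next_above_histories[OF assms(1)] True unfolding below[symmetric] by blast
  moreover have "card (online_max_histories h C x) = (n + h - m) choose (h + 1 - m)"
    using card_online_max_histories[OF assms(1,3), of h] True assms below by (simp add: m_def)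
  ultimately show ?thesis
    using binomial_rank_comparison[of h n m] assms(5) True m by (simp only:)
next
  case False
  \<comment> \<open>For \<open>h = 0\<close> the ratio is 0, even at \<open>n = 1\<close>, where it
    reads \<open>0 / 0\<close>. Otherwise \<open>x\<close> is never the online maximum.\<close>
  then have "h = 0 \<or> card (online_max_histories h C x) = 0"
    using card_online_max_histories[OF assms(1,3), of h] assms(2,4) by auto
  then show ?thesis by auto
qed

theorem theorem1:
  fixes n h :: nat
  assumes "n \<ge> 1" and "h \<le> n - 1"
  shows "competitive n h (real h / (real n + real h - 1)) (algorithm1 :: 'a::linorder algorithm)"
  unfolding competitive_def
proof (intro allI impI, elim conjE)
  fix C :: "'a candidate set" and \<sigma>
  assume C: "finite C" "card C = n + h" "\<forall>x\<in>C. 0 \<le> val x" "ordering_strategy h C \<sigma>"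
  define r where "r = real h / (real n + real h - 1)"
  have "r * (\<Sum>H\<in>histories h C. val (Max (C - H)))
      = (\<Sum>x\<in>C. r * real (card (online_max_histories h C x)) * val x)"
    using sum_online_max_eq[of C h] C assms by (simp add: sum_distrib_left mult.assoc)
  \<comment> \<open>Nonnegativity of the values allows the coefficients to be compared
    separately.\<close>
  also have "\<dots> \<le> (\<Sum>x\<in>C. real (card (next_above_histories h C x)) * val x)"
    unfolding r_def using C assms
    by (intro sum_mono mult_right_mono card_histories_comparison) auto
  also have "\<dots> \<le> (\<Sum>H\<in>histories h C.
      measure_pmf.expectation (run algorithm1 n H [] (\<sigma> H)) accepted_value)"
    using C by (intro sum_algorithm1_ge)
  finally show "r * expected_OPT h C \<le> expected_ALG algorithm1 n h C \<sigma>"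
    using C by (simp add: expected_ALG_eq_sum expected_OPT_eq_sum divide_right_mono)
qed

end
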